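(* Let $d>2$. For any convex body $\mathbf{K}$ in $\mathbb{S}^d$ and any $\varepsilon>0$, there is a convex body $\mathbf{K}'\subset\mathbf{K}$ in $\mathbb{S}^d$ such that $\mathbf{K}\setminus\mathbf{K}'$ is contained in a spherical cap of radius $\varepsilon$, and $I_{\mathbb{S}^d}(\mathbf{K}')=d+1$.
   Context: $\mathbb{S}^d$ denotes the unit sphere of Euclidean space $\mathbb{E}^{d+1}$ centered at the origin, regarded as the $d$-dimensional spherical space. A subset of $\mathbb{S}^d$ is spherically convex if it is contained in an open hemisphere of $\mathbb{S}^d$ and, for any two of its points, it contains the spherical segment (the shorter unit circle arc) connecting them. A convex body in $\mathbb{S}^d$ is a compact spherically convex set with nonempty interior. A spherical cap of radius $\varepsilon$ is a ball of angular radius $\varepsilon$ in $\mathbb{S}^d$. Illumination: let $\mathbf{K}\subset\mathbb{S}^d$ be a convex body and $\mathbf{p}\in\mathbb{S}^d\setminus\mathbf{K}$. A boundary point $\mathbf{q}\in\operatorname{bd}\mathbf{K}$ is illuminated from $\mathbf{p}$ if $\mathbf{q}\neq-\mathbf{p}$, the spherical segment with endpoints $\mathbf{p},\mathbf{q}$ does not intersect $\operatorname{int}\mathbf{K}$, and the greatcircle through $\mathbf{p}$ and $\mathbf{q}$ does intersect $\operatorname{int}\mathbf{K}$. $\mathbf{K}$ is illuminated from a set $S\subset\mathbb{S}^d\setminus\mathbf{K}$ if every boundary point of $\mathbf{K}$ is illuminated from at least one point of $S$. The illumination number $I_{\mathbb{S}^d}(\mathbf{K})$ is the smallest cardinality of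 a set $S$ that illuminates $\mathbf{K}$ and lies on a $(d-1)$-dimensional greatsphere of $\mathbb{S}^d$ disjoint from $\mathbf{K}$. *)

theory Defs
  imports "HOL-Analysis.Analysis" "HOL-Library.Extended_Nat"
begin

text \<open>
  The space \<open>S^d\<close> is the unit sphere of a Euclidean space \<open>'a\<close> with \<open>DIM('a) = d + 1\<close>.
\<close>

abbreviation unit_sphere :: "'a::euclidean_space set" where
  "unit_sphere \<equiv> sphere 0 1"

abbreviation sph_interior :: "'a::euclidean_space set \<Rightarrow> 'a set" where
  "sph_interior K \<equiv> top_of_set unit_sphere interior_of K"

abbreviation sph_boundary :: "'a::euclidean_space set \<Rightarrow> 'a set" where
  "sph_boundary K \<equiv> top_of_set unit_sphere frontier_of K"

definition open_hemisphere :: "'a::euclidean_space \<Rightarrow> 'a set" where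
  "open_hemisphere u = {x \<in> unit_sphere. u \<bullet> x > 0}"

text \<open>
  For \<open>q \<noteq> -p\<close>, the shorter great-circle arc from \<open>p\<close> to \<open>q\<close> consists of the unit vectors in
  the convex cone spanned by \<open>p\<close> and \<open>q\<close>; it is \<open>{p}\<close> if \<open>p = q\<close>. Antipodal pairs have no
  shorter arc, and the definition is never used for them: they do not occur in an open
  hemisphere, and illumination excludes them explicitly.
\<close>
definition sph_segment :: "'a::euclidean_space \<Rightarrow> 'a \<Rightarrow> 'a set" where
  "sph_segment p q = {x \<in> unit_sphere. \<exists>a\<ge>0. \<exists>b\<ge>0. x = a *\<^sub>R p + b *\<^sub>R q}"

definition sph_convex :: "'a::euclidean_space set \<Rightarrow> bool" where
  "sph_convex K \<longleftrightarrow>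
     (\<exists>u\<in>unit_sphere. K \<subseteq> open_hemisphere u) \<and> (\<forall>p\<in>K. \<forall>q\<in>K. sph_segment p q \<subseteq> K)"

definition sph_convex_body :: "'a::euclidean_space set \<Rightarrow> bool" where
  "sph_convex_body K \<longleftrightarrow> compact K \<and> sph_convex K \<and> sph_interior K \<noteq> {}"

definition sph_cap :: "'a::euclidean_space \<Rightarrow> real \<Rightarrow> 'a set" where
  "sph_cap c r = {x \<in> unit_sphere. arccos (c \<bullet> x) \<le> r}"

definition greatsphere :: "nat \<Rightarrow> 'a::euclidean_space set \<Rightarrow> bool" where
  "greatsphere k G \<longleftrightarrow> (\<exists>V. subspace V \<and> dim V = k + 1 \<and> G = V \<inter> unit_sphere)"

text \<open>The greatcircle through \<open>p\<close> and \<open>q\<close>, for \<open>q \<noteq> p\<close> and \<open>q \<noteq> -p\<close>.\<close>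
definition greatcircle :: "'a::euclidean_space \<Rightarrow> 'a \<Rightarrow> 'a set" where
  "greatcircle p q = span {p, q} \<inter> unit_sphere"

definition illuminated_from :: "'a::euclidean_space set \<Rightarrow> 'a \<Rightarrow> 'a \<Rightarrow> bool" where
  "illuminated_from K p q \<longleftrightarrow>
     q \<noteq> -p \<and> sph_segment p q \<inter> sph_interior K = {} \<and> greatcircle p q \<inter> sph_interior K \<noteq> {}"

definition illuminates :: "'a::euclidean_space set \<Rightarrow> 'a set \<Rightarrow> bool" where
  "illuminates S K \<longleftrightarrow>
     S \<subseteq> unit_sphere - K \<and> (\<forall>q\<in>sph_boundary K. \<exists>p\<in>S. illuminated_from K p q)"

text \<open>
  The greatsphere has dimension \<open>d - 1 = DIM('a) - 2\<close>. The value is \<open>\<infinity>\<close> if no finite set is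
  admissible.
\<close>
definition illumination_number :: "'a::euclidean_space set \<Rightarrow> enat" where
  "illumination_number K =
     Inf {enat (card S) | S. finite S \<and> illuminates S K \<and>
            (\<exists>G. greatsphere (DIM('a) - 2) G \<and> G \<inter> K = {} \<and> S \<subseteq> G)}"

end

theory Submission imports Defs begin

text \<open>
  Cut \<open>K\<close> by a spherical cap \<open>c \<bullet> y \<ge> \<rho>\<close>, where \<open>c \<bullet> y\<close> has a unique minimizer \<open>x\<close> on \<open>K\<close> and \<open>\<rho>\<close> is
  slightly larger than the minimum, and let \<open>p\<close> be a point of the rim of the cap in the interior of
  \<open>K\<close>. Choose a hyperplane \<open>V\<close> missing the truncated body and a point \<open>h\<close> of \<open>V\<close> just outside the cap
  near \<open>p\<close>. Every spherical segment from \<open>p\<close> to the boundary of \<open>K\<close> runs through the interior of the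
  truncated body, so \<open>-h\<close> illuminates all of the body except points in the interior of \<open>K\<close>, where the
  boundary is smooth. There the usual argument for smooth bodies applies: if \<open>h\<close> is the sum of a
  basis of \<open>V\<close>, then \<open>-h\<close> and the basis vectors suffice. Fewer than \<open>d + 1\<close> sources never suffice.
\<close>

section \<open>Cones over spherical sets and their interiors\<close>

definition punctured_cone :: "'a::euclidean_space set \<Rightarrow> 'a set" where
  "punctured_cone K = {y. y \<noteq> 0 \<and> sgn y \<in> K}"

lemma punctured_cone_scale_iff:
  assumes "t > 0"
  shows "t *\<^sub>R y \<in> punctured_cone K \<longleftrightarrow> y \<in> punctured_cone K"
  using assms by (auto simp: punctured_cone_def sgn_scaleR)

lemma mem_punctured_cone_unit:
  assumes "norm q = 1"
  shows "q \<in> punctured_cone K \<longleftrightarrow> q \<in> K"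
  using assms by (auto simp: punctured_cone_def sgn_div_norm)

lemma subset_unit_sphere:
  assumes "sph_convex K"
  shows "K \<subseteq> unit_sphere"
  using assms by (auto simp: sph_convex_def open_hemisphere_def)

lemma sgn_mem_unit_sphere: "y \<noteq> 0 \<Longrightarrow> sgn y \<in> unit_sphere"
  by (simp add: norm_sgn)

text \<open>The direction of a sum is a nonnegative combination of the two directions, so it lies on
  their spherical segment. The normal \<open>u\<close> of the hemisphere is positive on the cone,
  which keeps the sum away from 0. Arcs can thus be replaced by vector addition.\<close>

lemma punctured_cone_add:
  assumes K: "sph_convex K" and x: "x \<in> punctured_cone K" and y: "y \<in> punctured_cone K"
  shows "x + y \<in> punctured_cone K"
proof -
  obtain u where u: "K \<subseteq> open_hemisphere u" using K by (auto simp: sph_convex_def)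
  have pos: "u \<bullet> z > 0" if "z \<in> punctured_cone K" for z
  proof -
    have "u \<bullet> sgn z > 0" "z \<noteq> 0"
      using that u by (auto simp: punctured_cone_def open_hemisphere_def)
    then show ?thesis by (simp add: sgn_div_norm zero_less_mult_iff)
  qed
  have "u \<bullet> (x + y) > 0" using pos[OF x] pos[OF y] by (simp add: inner_add_right)
  then have nz: "x + y \<noteq> 0" by auto
  have "sgn (x + y) = (norm x / norm (x + y)) *\<^sub>R sgn x + (norm y / norm (x + y)) *\<^sub>R sgn y"
    using x y by (simp add: sgn_div_norm punctured_cone_def scaleR_add_right field_simps)
  moreover have "norm x / norm (x + y) \<ge> 0" "norm y / norm (x + y) \<ge> 0" by simp_all
  ultimately have "sgn (x + y) \<in> sph_segment (sgn x) (sgn y)"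
    using sgn_mem_unit_sphere[OF nz] unfolding sph_segment_def by blast
  moreover have "sgn x \<in> K" "sgn y \<in> K" using x y by (auto simp: punctured_cone_def)
  ultimately have "sgn (x + y) \<in> K" using K by (auto simp: sph_convex_def)
  with nz show ?thesis by (simp add: punctured_cone_def)
qed

lemma interior_punctured_cone_add:
  assumes K: "sph_convex K" and x: "x \<in> interior (punctured_cone K)" and y: "y \<in> punctured_cone K"
  shows "x + y \<in> interior (punctured_cone K)"
proof (rule interiorI)
  show "open ((+) y ` interior (punctured_cone K))" by (simp add: open_translation)
  show "x + y \<in> (+) y ` interior (punctured_cone K)" using x by (auto simp: add.commute)
  show "(+) y ` interior (punctured_cone K) \<subseteq> punctured_cone K"
    using punctured_cone_add[OF K y] interior_subset by blast
qed

lemma interior_punctured_cone_scale: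
  assumes x: "x \<in> interior (punctured_cone K)" and t: "t > 0"
  shows "t *\<^sub>R x \<in> interior (punctured_cone K)"
proof (rule interiorI)
  show "open ((*\<^sub>R) t ` interior (punctured_cone K))" using t by (simp add: open_scaling)
  show "t *\<^sub>R x \<in> (*\<^sub>R) t ` interior (punctured_cone K)" using x by auto
  show "(*\<^sub>R) t ` interior (punctured_cone K) \<subseteq> punctured_cone K"
    using subsetD[OF interior_subset, of _ "punctured_cone K"] t
    by (auto simp: punctured_cone_scale_iff)
qed

text \<open>Radial projection \<open>sgn\<close> is continuous off 0, so it pulls relatively open
  subsets of the sphere back to open subsets of the ambient space; conversely, the cone meets the
  sphere only in \<open>K\<close>.\<close>

lemma sph_interior_iff:
  fixes q :: "'a::euclidean_space"
  shows "q \<in> sph_interior K \<longleftrightarrow> norm q = 1 \<and> q \<in> interior (punctured_cone K)"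
proof
  assume q: "q \<in> sph_interior K"
  then obtain T where T: "openin (top_of_set unit_sphere) T" "q \<in> T" "T \<subseteq> K"
    by (auto simp: interior_of_def)
  have nq: "norm q = 1" using openin_imp_subset[OF T(1)] T(2) by auto
  obtain W where W: "open W" "T = unit_sphere \<inter> W" using T(1) by (auto simp: openin_open)
  have "continuous_on (- {0}) (sgn :: 'a \<Rightarrow> 'a)"
    by (intro continuous_intros) auto
  moreover have "open (- {0} :: 'a set)" by (intro open_Compl closed_singleton)
  ultimately have "open (sgn -` W \<inter> - {0})"
    using W(1) continuous_on_open_vimage[of "- {0}" sgn] by blast
  moreover have "q \<in> sgn -` W \<inter> - {0}" using nq T(2) W(2) by (auto simp: sgn_div_norm)
  moreover have "sgn -` W \<inter> - {0} \<subseteq> punctured_cone K"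
  proof
    fix y assume y: "y \<in> sgn -` W \<inter> - {0}"
    then have "sgn y \<in> T" using sgn_mem_unit_sphere[of y] by (simp add: W(2))
    then show "y \<in> punctured_cone K" using y T(3) by (auto simp: punctured_cone_def)
  qed
  ultimately show "norm q = 1 \<and> q \<in> interior (punctured_cone K)"
    using nq by (auto intro: interiorI)
next
  assume q: "norm q = 1 \<and> q \<in> interior (punctured_cone K)"
  have "openin (top_of_set unit_sphere) (unit_sphere \<inter> interior (punctured_cone K))"
    by (simp add: openin_open_Int)
  moreover have "unit_sphere \<inter> interior (punctured_cone K) \<subseteq> K"
  proof
    fix y assume "y \<in> unit_sphere \<inter> interior (punctured_cone K)"
    then have "norm y = 1" "y \<in> punctured_cone K"
      using subsetD[OF interior_subset, of y] by auto
    then show "y \<in> K" by (simp add: mem_punctured_cone_unit)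
  qed
  ultimately show "q \<in> sph_interior K" using q by (auto simp: interior_of_def)
qed

lemma sph_boundary_eq:
  assumes "compact K" "K \<subseteq> unit_sphere"
  shows "sph_boundary K = K - sph_interior K"
proof -
  have "closedin (top_of_set unit_sphere) K"
    using assms by (intro closed_subset compact_imp_closed)
  then show ?thesis by (simp add: frontier_of_def closure_of_closedin)
qed

lemma interior_punctured_cone_halfspace:
  assumes "\<And>x. x \<in> K \<Longrightarrow> f \<bullet> x \<ge> 0" and "f \<noteq> 0" and "y \<in> interior (punctured_cone K)"
  shows "f \<bullet> y > 0"
proof -
  have "punctured_cone K \<subseteq> {x. f \<bullet> x \<ge> 0}"
  proof
    fix x assume "x \<in> punctured_cone K"
    then have "f \<bullet> sgn x \<ge> 0" "x \<noteq> 0" using assms(1) by (auto simp: punctured_cone_def)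
    then show "x \<in> {x. f \<bullet> x \<ge> 0}" by (simp add: sgn_div_norm zero_le_mult_iff)
  qed
  then have "y \<in> interior {x. f \<bullet> x \<ge> 0}" using assms(3) interior_mono by blast
  then show ?thesis using assms(2) by simp
qed

text \<open>If \<open>v\<close> took both signs, positive multiples of two points could be added so
  that the values of \<open>v\<close> cancel; the direction of the sum would be a point of
  \<open>K\<close> in the hyperplane.\<close>

lemma disjoint_hyperplane_sign:
  assumes K: "sph_convex K" and dis: "\<And>x. x \<in> K \<Longrightarrow> v \<bullet> x \<noteq> 0"
  shows "(\<forall>x\<in>K. v \<bullet> x > 0) \<or> (\<forall>x\<in>K. v \<bullet> x < 0)"
proof (rule ccontr)
  assume "\<not> ?thesis"
  then obtain x y where xy: "x \<in> K" "y \<in> K" "v \<bullet> x > 0" "v \<bullet> y < 0"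
    using dis by (meson linorder_neqE_linordered_idom)
  have "norm x = 1" "norm y = 1" using xy subset_unit_sphere[OF K] by auto
  then have "(- (v \<bullet> y)) *\<^sub>R x \<in> punctured_cone K" "(v \<bullet> x) *\<^sub>R y \<in> punctured_cone K"
    using xy by (simp_all only: punctured_cone_scale_iff mem_punctured_cone_unit neg_0_less_iff_less)
  from punctured_cone_add[OF K this]
  have *: "sgn ((- (v \<bullet> y)) *\<^sub>R x + (v \<bullet> x) *\<^sub>R y) \<in> K" by (simp add: punctured_cone_def)
  have "v \<bullet> sgn ((- (v \<bullet> y)) *\<^sub>R x + (v \<bullet> x) *\<^sub>R y) = 0"
    by (simp add: sgn_div_norm inner_add_right inner_diff_right)
  then show False using dis[OF *] by simp
qed

section \<open>A linear criterion for illumination\<close>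

text \<open>Stepping from \<open>q\<close> away from the source enters the interior, and the point
  reached shows that the greatcircle meets it. If the segment to the source met the interior too,
  adding a multiple of the point reached would cancel the source component and put a positive
  multiple of \<open>q\<close> into the interior. The functional \<open>v\<close> excludes that
  \<open>q\<close> is antipodal to the source.\<close>

lemma illuminated_from_sgnI:
  assumes K: "sph_convex K" and v: "v \<bullet> w = 0" "\<And>x. x \<in> K \<Longrightarrow> v \<bullet> x > 0"
    and w: "w \<noteq> 0" and q: "q \<in> K - sph_interior K"
    and s: "s > 0" "q - s *\<^sub>R w \<in> interior (punctured_cone K)"
  shows "illuminated_from K (sgn w) q"
proof -
  let ?J = "interior (punctured_cone K)"
  define r where "r = s * norm w"
  have r: "r > 0" "q - r *\<^sub>R sgn w \<in> ?J" using s w by (simp_all add: r_def sgn_div_norm mult.assoc)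
  have nq: "norm q = 1" using q subset_unit_sphere[OF K] by auto
  have qJ: "q \<notin> ?J" using q nq by (auto simp: sph_interior_iff)
  have qP: "q \<in> punctured_cone K" using q nq by (simp add: mem_punctured_cone_unit)
  have vw: "v \<bullet> sgn w = 0" using v(1) by (simp add: sgn_div_norm)
  have vq: "v \<bullet> q > 0" using v(2) q by auto
  have "q \<noteq> - sgn w" using vq vw by auto
  moreover have "sph_segment (sgn w) q \<inter> sph_interior K = {}"
  proof (rule ccontr)
    assume "\<not> ?thesis"
    then obtain y where y: "y \<in> sph_segment (sgn w) q" "y \<in> sph_interior K" by blast
    then obtain a b where ab: "a \<ge> 0" "b \<ge> 0" "y = a *\<^sub>R sgn w + b *\<^sub>R q"
      by (auto simp: sph_segment_def)
    have yJ: "y \<in> ?J" "norm y = 1" using y(2) by (auto simp: sph_interior_iff)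
    have pos: "b + a / r > 0"
    proof (rule ccontr)
      assume *: "\<not> ?thesis"
      have "a / r \<ge> 0" using ab(1) r(1) by simp
      then have "b = 0" "a / r = 0" using * ab(2) by linarith+
      then show False using yJ(2) ab(3) r(1) by simp
    qed
    have "(b + a / r) *\<^sub>R q \<in> ?J"
    proof (cases "a = 0")
      case True
      then show ?thesis using yJ ab by simp
    next
      case False
      then have "(a / r) *\<^sub>R (q - r *\<^sub>R sgn w) \<in> ?J"
        using ab(1) r by (intro interior_punctured_cone_scale) auto
      then have "y + (a / r) *\<^sub>R (q - r *\<^sub>R sgn w) \<in> ?J"
        using interior_punctured_cone_add[OF K yJ(1)] interior_subset by blast
      moreover have "y + (a / r) *\<^sub>R (q - r *\<^sub>R sgn w) = (b + a / r) *\<^sub>R q"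
        using r(1) by (simp add: ab(3) algebra_simps)
      ultimately show ?thesis by simp
    qed
    from interior_punctured_cone_scale[OF this, of "inverse (b + a / r)"] pos
    have "q \<in> ?J" by simp
    with qJ show False ..
  qed
  moreover have "greatcircle (sgn w) q \<inter> sph_interior K \<noteq> {}"
  proof -
    let ?y = "q - r *\<^sub>R sgn w"
    have nz: "?y \<noteq> 0" using subsetD[OF interior_subset r(2)] by (simp add: punctured_cone_def)
    then have "sgn ?y \<in> ?J"
      using interior_punctured_cone_scale[OF r(2), of "inverse (norm ?y)"]
      by (simp add: sgn_div_norm divide_inverse_commute)
    then have "sgn ?y \<in> sph_interior K" using nz by (simp add: sph_interior_iff norm_sgn)
    moreover have "?y \<in> span {sgn w, q}" by (intro span_diff span_scale span_base) auto
    then have "sgn ?y \<in> span {sgn w, q}" by (simp add: sgn_div_norm span_scale)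
    ultimately show ?thesis using nz unfolding greatcircle_def by (force simp: norm_sgn)
  qed
  ultimately show ?thesis by (simp add: illuminated_from_def)
qed

section \<open>Lower bound on the number of sources\<close>

text \<open>Without one point \<open>p\<close>, the set is too small to span \<open>V\<close>, so
  some nonzero \<open>w\<close> in \<open>V\<close> is orthogonal to all the others; its sign is
  then chosen to suit \<open>p\<close>.\<close>

lemma exists_nonneg_inner_on_subspace:
  fixes V :: "'a::euclidean_space set"
  assumes V: "subspace V" "dim V > 0" and S: "finite S" "S \<subseteq> V" "card S \<le> dim V"
  obtains w where "w \<in> V" "w \<noteq> 0" "\<And>p. p \<in> S \<Longrightarrow> w \<bullet> p \<ge> 0"
proof -
  obtain p R where R: "S \<subseteq> insert p R" "R \<subseteq> V" "card R < dim V" "finite R"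
  proof (cases "S = {}")
    case True
    \<comment> \<open>For empty \<open>S\<close> a dummy point \<open>0\<close> stands in for
      \<open>p\<close>; the empty \<open>R\<close> still fails to span \<open>V\<close> because
      \<open>dim V > 0\<close>.\<close>
    then show ?thesis using that[of 0 "{}"] V(2) by auto
  next
    case False
    then obtain p where "p \<in> S" by blast
    moreover have "card (S - {p}) < card S" using S(1) \<open>p \<in> S\<close> by (rule card_Diff1_less)
    ultimately show ?thesis using that[of p "S - {p}"] S by auto
  qed
  have "dim R < dim V" using dim_le_card'[OF R(4)] R(3) by simp
  then have "span R \<noteq> span V" by (metis dim_span less_irrefl)
  then have "span R \<subset> span V" using span_mono[OF R(2)] by blast
  then obtain w where w: "w \<noteq> 0" "w \<in> span V" "\<And>y. y \<in> span R \<Longrightarrow> orthogonal w y"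
    using orthogonal_to_subspace_exists_gen by blast
  have "span V = V" using V(1) by (simp only: span_eq_iff)
  with w(2) have wV: "w \<in> V" by simp
  have wR: "w \<bullet> y = 0" if "y \<in> R" for y using w(3)[OF span_base[OF that]] by (simp add: orthogonal_def)
  show ?thesis
  proof (cases "w \<bullet> p \<ge> 0")
    case True
    then have "w \<bullet> y \<ge> 0" if "y \<in> S" for y
      using that wR[of y] R(1) by (cases "y = p") auto
    then show ?thesis using that[OF wV w(1)] by blast
  next
    case False
    then have "(- w) \<bullet> y \<ge> 0" if "y \<in> S" for y
      using that wR[of y] R(1) by (cases "y = p") auto
    moreover have "- w \<in> V" "- w \<noteq> 0" using wV w(1) V(1) by (simp_all add: subspace_neg)
    ultimately show ?thesis using that[of "- w"] by blast
  qed
qed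

text \<open>
  If \<open>S\<close> has at most \<open>dim V\<close> points, some \<open>w \<noteq> 0\<close> in \<open>V\<close> is nonnegative on \<open>S\<close>; tilting it by a
  normal of \<open>V\<close> until it supports \<open>K\<close> does not change its values on \<open>S\<close>, and the contact point
  is not illuminated.
\<close>
lemma card_illuminating_ge:
  fixes K :: "'a::euclidean_space set"
  assumes dim: "DIM('a) \<ge> 2" and K: "sph_convex_body K"
    and S: "finite S" "illuminates S K" "S \<subseteq> G"
    and G: "greatsphere (DIM('a) - 2) G" "G \<inter> K = {}"
  shows "card S \<ge> DIM('a)"
proof (rule ccontr)
  assume small: "\<not> ?thesis"
  obtain V where V: "subspace V" "dim V = DIM('a) - 1" "G = V \<inter> unit_sphere"
  proof -
    have "DIM('a) - 2 + 1 = DIM('a) - 1" using dim by linarith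
    then show ?thesis using that G(1) unfolding greatsphere_def by metis
  qed
  have cK: "compact K" and sK: "sph_convex K" and iK: "sph_interior K \<noteq> {}"
    using K by (auto simp: sph_convex_body_def)
  note sub = subset_unit_sphere[OF sK]
  have neK: "K \<noteq> {}" using iK by auto
  obtain a where a: "a \<noteq> 0" "span V = {x. a \<bullet> x = 0}" using lowdim_eq_hyperplane[OF V(2)] by blast
  then have Va: "V = {x. a \<bullet> x = 0}" using V(1) by (metis span_eq_iff)
  have "a \<bullet> x \<noteq> 0" if "x \<in> K" for x using that G(2) V(3) Va sub by auto
  from disjoint_hyperplane_sign[OF sK this]
  obtain v where v: "V = {x. v \<bullet> x = 0}" "\<And>x. x \<in> K \<Longrightarrow> v \<bullet> x > 0"
  proof
    assume "\<forall>x\<in>K. a \<bullet> x > 0"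
    then show ?thesis using that[of a] Va by auto
  next
    assume "\<forall>x\<in>K. a \<bullet> x < 0"
    then show ?thesis using that[of "- a"] Va by auto
  qed
  have "S \<subseteq> V" "card S \<le> dim V" "dim V > 0" using S(3) V dim small by auto
  then obtain w where w: "w \<in> V" "w \<noteq> 0" "\<And>p. p \<in> S \<Longrightarrow> w \<bullet> p \<ge> 0"
    using exists_nonneg_inner_on_subspace[OF V(1) _ S(1)] by blast
  \<comment> \<open>The minimum of this ratio is the largest \<open>t\<close> for which
    \<open>w - t v\<close> stays nonnegative on \<open>K\<close>; a minimizer \<open>q\<close> is
    the contact point.\<close>
  have "continuous_on K (\<lambda>x. (w \<bullet> x) / (v \<bullet> x))"
    using v(2) by (intro continuous_intros) (auto simp: less_imp_neq[symmetric])
  from continuous_attains_inf[OF cK neK this]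
  obtain q where q: "q \<in> K" "\<And>x. x \<in> K \<Longrightarrow> (w \<bullet> q) / (v \<bullet> q) \<le> (w \<bullet> x) / (v \<bullet> x)" by blast
  define t where "t = (w \<bullet> q) / (v \<bullet> q)"
  define f where "f = w - t *\<^sub>R v"
  have f_nonneg: "f \<bullet> x \<ge> 0" if "x \<in> K" for x
    using q(2)[OF that] v(2)[OF that]
    by (simp add: f_def inner_diff_left t_def[symmetric] pos_le_divide_eq)
  have fq: "f \<bullet> q = 0" using v(2)[OF q(1)] by (simp add: f_def inner_diff_left t_def)
  \<comment> \<open>\<open>w\<close> lies in \<open>V\<close>, hence is orthogonal to
    \<open>v\<close>, and cannot be a multiple of \<open>v\<close> without vanishing.\<close>
  have "f \<noteq> 0"
  proof
    assume "f = 0"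
    then have "w = t *\<^sub>R v" by (simp add: f_def)
    then have "w \<bullet> w = t * (v \<bullet> w)" by (metis inner_scaleR_left)
    then show False using w(1,2) v(1) by auto
  qed
  then have f_pos: "f \<bullet> y > 0" if "y \<in> interior (punctured_cone K)" for y
    using interior_punctured_cone_halfspace f_nonneg that by blast
  have "q \<in> K - sph_interior K" using q(1) f_pos[of q] fq by (auto simp: sph_interior_iff)
  then obtain p where p: "p \<in> S" "illuminated_from K p q"
    using S(2) by (auto simp: illuminates_def sph_boundary_eq[OF cK sub])
  then obtain y where y: "y \<in> greatcircle p q" "y \<in> sph_interior K"
    by (auto simp: illuminated_from_def)
  obtain \<alpha> \<beta> where ab: "y = \<alpha> *\<^sub>R p + \<beta> *\<^sub>R q"
  proof -
    have "y \<in> span {p, q}" using y(1) by (simp add: greatcircle_def)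
    then obtain k where "y - k *\<^sub>R p \<in> span {q}" by (auto simp: span_insert)
    then obtain l where "y - k *\<^sub>R p = l *\<^sub>R q" by (auto simp: span_singleton)
    then show ?thesis using that[of k l] by (simp add: algebra_simps)
  qed
  \<comment> \<open>Two functionals read off the signs of the coefficients: \<open>f\<close>
    vanishes at \<open>q\<close> and gives \<alpha> \<ge> 0, \<open>v\<close> vanishes at
    \<open>p\<close> and gives \<beta> \<ge> 0. So the interior point \<open>y\<close> of the
    greatcircle already lies on the segment.\<close>
  have vp: "v \<bullet> p = 0" using p(1) \<open>S \<subseteq> V\<close> v(1) by auto
  have fp: "f \<bullet> p \<ge> 0" using w(3)[OF p(1)] vp by (simp add: f_def inner_diff_left)
  have "f \<bullet> y > 0" using f_pos y(2) by (simp add: sph_interior_iff)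
  then have "\<alpha> * (f \<bullet> p) > 0" using fq by (simp add: ab inner_add_right)
  then have "\<alpha> \<ge> 0" using fp by (simp add: zero_less_mult_iff)
  moreover have "v \<bullet> y > 0" using v(2) subsetD[OF interior_of_subset y(2)] by blast
  then have "\<beta> \<ge> 0" using vp v(2)[OF q(1)] by (simp add: ab inner_add_right zero_less_mult_iff)
  ultimately have "y \<in> sph_segment p q"
    using ab y(2) unfolding sph_segment_def by (auto simp: sph_interior_iff)
  then show False using y(2) p(2) by (auto simp: illuminated_from_def)
qed

section \<open>Strict minimizers and truncation by a cap\<close>

text \<open>Let \<open>u\<close> be the normal of a hemisphere and \<open>x\<close> any minimizer of
  it on \<open>K\<close>. Tilting to \<open>c = u - t x\<close> makes the minimum strict, with a gap
  controlled by the angle to \<open>x\<close>; taking \<open>t\<close> as half of the minimum keeps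
  the new minimum positive.\<close>

lemma exists_strict_inner_minimizer:
  fixes K :: "'a::euclidean_space set"
  assumes K: "sph_convex_body K"
  obtains x t \<mu> c where "x \<in> K" "t > 0" "\<mu> > 0" "c \<bullet> x = \<mu>"
    "\<And>y. y \<in> K \<Longrightarrow> c \<bullet> y \<ge> \<mu> + t * (1 - x \<bullet> y)"
proof -
  have cK: "compact K" and sK: "sph_convex K" and iK: "sph_interior K \<noteq> {}"
    using K by (auto simp: sph_convex_body_def)
  obtain u where u: "K \<subseteq> open_hemisphere u" using sK by (auto simp: sph_convex_def)
  have neK: "K \<noteq> {}" using iK by auto
  have "continuous_on K (\<lambda>y. u \<bullet> y)" by (intro continuous_intros)
  from continuous_attains_inf[OF cK neK this]
  obtain x where x: "x \<in> K" "\<And>y. y \<in> K \<Longrightarrow> u \<bullet> x \<le> u \<bullet> y" by blast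
  define t where "t = (u \<bullet> x) / 2"
  have pos: "u \<bullet> x > 0" using u x(1) by (auto simp: open_hemisphere_def)
  have "x \<bullet> x = 1" using x(1) subset_unit_sphere[OF sK] by (auto simp: dot_square_norm)
  then have "(u - t *\<^sub>R x) \<bullet> x = t" by (simp add: inner_diff_left t_def)
  moreover have "(u - t *\<^sub>R x) \<bullet> y \<ge> t + t * (1 - x \<bullet> y)" if "y \<in> K" for y
    using x(2)[OF that] by (simp add: inner_diff_left right_diff_distrib) (simp add: t_def)
  moreover have "t > 0" using pos by (simp add: t_def)
  ultimately show ?thesis using that[of x t t "u - t *\<^sub>R x"] x(1) by blast
qed

text \<open>For a unit vector \<open>a p + b q\<close> the triangle inequality gives
  \<open>a + b \<ge> 1\<close>; as \<rho> is positive, the bound at the endpoints carries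
  over.\<close>

lemma sph_convex_Int_cap:
  assumes K: "sph_convex K" and \<rho>: "\<rho> > 0"
  shows "sph_convex {y \<in> K. c \<bullet> y \<ge> \<rho>}"
proof -
  have "sph_segment p q \<subseteq> {y \<in> K. c \<bullet> y \<ge> \<rho>}"
    if pq: "p \<in> K" "q \<in> K" "c \<bullet> p \<ge> \<rho>" "c \<bullet> q \<ge> \<rho>" for p q
  proof
    fix y assume y: "y \<in> sph_segment p q"
    then obtain a b where ab: "a \<ge> 0" "b \<ge> 0" "y = a *\<^sub>R p + b *\<^sub>R q" "norm y = 1"
      by (auto simp: sph_segment_def)
    have "norm p = 1" "norm q = 1" using pq subset_unit_sphere[OF K] by auto
    then have "a + b \<ge> 1" using norm_triangle_ineq[of "a *\<^sub>R p" "b *\<^sub>R q"] ab by simp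
    then have "\<rho> \<le> (a + b) * \<rho>" using \<rho> by simp
    also have "\<dots> \<le> a * (c \<bullet> p) + b * (c \<bullet> q)"
      using pq ab by (simp add: distrib_right add_mono mult_left_mono)
    also have "\<dots> = c \<bullet> y" by (simp add: ab inner_add_right)
    finally show "y \<in> {y \<in> K. c \<bullet> y \<ge> \<rho>}" using y pq K by (auto simp: sph_convex_def)
  qed
  then show ?thesis using K unfolding sph_convex_def by blast
qed

lemma norm_add_less_add_norm:
  fixes p q :: "'a::real_inner"
  assumes "norm p = 1" "norm q = 1" "p \<noteq> q"
  shows "norm (q + p) < norm q + norm p"
proof -
  have "norm (q + p) \<noteq> norm q + norm p"
    using assms norm_triangle_eq[of q p] by simp
  then show ?thesis using norm_triangle_ineq[of q p] by linarith
qed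

text \<open>A second-order upper bound for the norm near a unit vector, obtained by completing the
  square.\<close>

lemma norm_unit_add_le:
  fixes q w :: "'a::real_inner"
  assumes "norm q = 1" "1 + s * (q \<bullet> w) \<ge> 0"
  shows "norm (q + s *\<^sub>R w) \<le> 1 + s * (q \<bullet> w) + s\<^sup>2 * (w \<bullet> w) / 2"
proof (rule power2_le_imp_le)
  have qq: "q \<bullet> q = 1" using assms(1) by (simp add: dot_square_norm)
  let ?x = "s * (q \<bullet> w)" and ?y = "s\<^sup>2 * (w \<bullet> w) / 2"
  have y: "?y \<ge> 0" by simp
  have "(norm (q + s *\<^sub>R w))\<^sup>2 = 1 + 2 * ?x + 2 * ?y"
    unfolding power2_norm_eq_inner
    by (simp add: inner_add_left inner_add_right qq inner_commute power2_eq_square)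
  also have "\<dots> = (1 + ?x + ?y)\<^sup>2 - (?x + ?y)\<^sup>2" by (simp add: power2_eq_square algebra_simps)
  also have "\<dots> \<le> (1 + ?x + ?y)\<^sup>2" by simp
  finally show "(norm (q + s *\<^sub>R w))\<^sup>2 \<le> (1 + ?x + ?y)\<^sup>2" .
  show "0 \<le> 1 + ?x + ?y" using y assms(2) by linarith
qed

text \<open>\<open>c - \<rho> q\<close> is the gradient at \<open>q\<close> of
  \<open>c \<bullet> y - \<rho> norm y\<close>, so it is the inner normal of the cone over the cap.
  For small \<open>s\<close> the linear gain along \<open>w\<close> beats the quadratic error of the
  norm.\<close>

lemma exists_step_into_open_cap:
  fixes q w c :: "'a::real_inner"
  assumes U: "open U" "q \<in> U" and q: "norm q = 1" "c \<bullet> q = \<rho>" and \<rho>: "\<rho> > 0"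
    and w: "(c - \<rho> *\<^sub>R q) \<bullet> w > 0"
  obtains s where "s > 0" "q + s *\<^sub>R w \<in> U" "c \<bullet> (q + s *\<^sub>R w) > \<rho> * norm (q + s *\<^sub>R w)"
proof -
  have "((\<lambda>s. q + s *\<^sub>R w) \<longlongrightarrow> q + 0 *\<^sub>R w) (at_right 0)" by (intro tendsto_intros)
  then have e1: "eventually (\<lambda>s. q + s *\<^sub>R w \<in> U) (at_right 0)"
    using U topological_tendstoD by fastforce
  have "((\<lambda>s. 1 + s * (q \<bullet> w)) \<longlongrightarrow> 1 + 0 * (q \<bullet> w)) (at_right 0)" by (intro tendsto_intros)
  then have e2: "eventually (\<lambda>s. 1 + s * (q \<bullet> w) > 0) (at_right 0)"
    by (rule order_tendstoD) simp
  have "((\<lambda>s. (c - \<rho> *\<^sub>R q) \<bullet> w - \<rho> * (s * (w \<bullet> w) / 2)) \<longlongrightarrow>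
      (c - \<rho> *\<^sub>R q) \<bullet> w - \<rho> * (0 * (w \<bullet> w) / 2)) (at_right 0)" by (intro tendsto_intros) auto
  then have e3: "eventually (\<lambda>s. (c - \<rho> *\<^sub>R q) \<bullet> w - \<rho> * (s * (w \<bullet> w) / 2) > 0) (at_right 0)"
    by (rule order_tendstoD) (use w in simp)
  have "eventually (\<lambda>s::real. s > 0) (at_right 0)" by (simp add: eventually_at_right_less)
  with e1 e2 e3 have "eventually (\<lambda>s. s > 0 \<and> q + s *\<^sub>R w \<in> U \<and> 1 + s * (q \<bullet> w) > 0
      \<and> (c - \<rho> *\<^sub>R q) \<bullet> w - \<rho> * (s * (w \<bullet> w) / 2) > 0) (at_right (0::real))"
    by eventually_elim auto
  then obtain s where s: "s > 0" "q + s *\<^sub>R w \<in> U" "1 + s * (q \<bullet> w) > 0"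
      "(c - \<rho> *\<^sub>R q) \<bullet> w - \<rho> * (s * (w \<bullet> w) / 2) > 0"
    using eventually_happens'[OF trivial_limit_at_right_real] by blast
  have "\<rho> * norm (q + s *\<^sub>R w) \<le> \<rho> * (1 + s * (q \<bullet> w) + s\<^sup>2 * (w \<bullet> w) / 2)"
    using norm_unit_add_le[OF q(1)] s(3) \<rho> by (intro mult_left_mono) auto
  also have "\<dots> = c \<bullet> (q + s *\<^sub>R w) - s * ((c - \<rho> *\<^sub>R q) \<bullet> w - \<rho> * (s * (w \<bullet> w) / 2))"
    by (simp add: inner_add_right inner_diff_left q(2) algebra_simps power2_eq_square)
  also have "\<dots> < c \<bullet> (q + s *\<^sub>R w)" using s(1,4) by simp
  finally show ?thesis using that s by blast
qed

lemma punctured_cone_Int_cap: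
  "y \<in> punctured_cone {x \<in> K. c \<bullet> x \<ge> \<rho>} \<longleftrightarrow> y \<in> punctured_cone K \<and> c \<bullet> y \<ge> \<rho> * norm y"
proof (cases "y = 0")
  case False
  then have "c \<bullet> sgn y \<ge> \<rho> \<longleftrightarrow> c \<bullet> y \<ge> \<rho> * norm y"
    by (simp add: sgn_div_norm field_simps)
  then show ?thesis by (auto simp: punctured_cone_def)
qed (simp add: punctured_cone_def)

lemma interior_punctured_cone_Int_cap:
  assumes "y \<in> interior (punctured_cone K)" "c \<bullet> y > \<rho> * norm y"
  shows "y \<in> interior (punctured_cone {x \<in> K. c \<bullet> x \<ge> \<rho>})"
proof (rule interiorI)
  have "open {y. \<rho> * norm y < c \<bullet> y}" by (intro open_Collect_less continuous_intros)
  then show "open (interior (punctured_cone K) \<inter> {y. \<rho> * norm y < c \<bullet> y})" by auto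
  show "y \<in> interior (punctured_cone K) \<inter> {y. \<rho> * norm y < c \<bullet> y}" using assms by auto
  show "interior (punctured_cone K) \<inter> {y. \<rho> * norm y < c \<bullet> y}
      \<subseteq> punctured_cone {x \<in> K. c \<bullet> x \<ge> \<rho>}"
  proof
    fix x assume "x \<in> interior (punctured_cone K) \<inter> {y. \<rho> * norm y < c \<bullet> y}"
    then have "x \<in> punctured_cone K" "\<rho> * norm x \<le> c \<bullet> x"
      using subsetD[OF interior_subset, of x] by auto
    then show "x \<in> punctured_cone {x \<in> K. c \<bullet> x \<ge> \<rho>}" by (simp add: punctured_cone_Int_cap)
  qed
qed

lemma sgn_in_sph_interior:
  assumes "z \<in> interior (punctured_cone K)"
  shows "sgn z \<in> sph_interior K"
proof -
  have "z \<noteq> 0" using subsetD[OF interior_subset assms] by (simp add: punctured_cone_def)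
  then show ?thesis
    using interior_punctured_cone_scale[OF assms, of "inverse (norm z)"]
    by (simp add: sph_interior_iff norm_sgn) (simp add: sgn_div_norm)
qed

lemma sph_convex_body_Int_cap:
  assumes K: "sph_convex_body K" and \<rho>: "\<rho> > 0"
    and z: "z \<in> interior (punctured_cone K)" "c \<bullet> z > \<rho> * norm z"
  shows "sph_convex_body {y \<in> K. c \<bullet> y \<ge> \<rho>}"
proof -
  have cK: "compact K" and sK: "sph_convex K" using K by (auto simp: sph_convex_body_def)
  have "closed {y. \<rho> \<le> c \<bullet> y}" by (intro closed_Collect_le continuous_intros)
  then have "compact (K \<inter> {y. \<rho> \<le> c \<bullet> y})" using cK by (rule compact_Int_closed[rotated])
  moreover have "K \<inter> {y. \<rho> \<le> c \<bullet> y} = {y \<in> K. c \<bullet> y \<ge> \<rho>}" by auto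
  ultimately show ?thesis
    using sph_convex_Int_cap[OF sK \<rho>] sgn_in_sph_interior[OF interior_punctured_cone_Int_cap[OF z]]
    unfolding sph_convex_body_def by auto
qed

section \<open>Construction of the illuminating set\<close>

text \<open>
  Replacing \<open>h\<close> in a basis of \<open>V\<close> by \<open>h\<close> minus the other basis vectors makes \<open>h\<close> the sum
  of the new basis.
\<close>
lemma exists_subset_detecting_nonpos:
  fixes V :: "'a::euclidean_space set"
  assumes V: "subspace V" and h: "h \<in> V" "h \<noteq> 0"
  obtains T where "finite T" "card T \<le> dim V" "T \<subseteq> V" "0 \<notin> T"
    "\<And>n. n \<bullet> h \<le> 0 \<Longrightarrow> (\<exists>w\<in>T. n \<bullet> w < 0) \<or> (\<forall>y\<in>V. n \<bullet> y = 0)"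
proof -
  have "independent {h}" using h(2) by simp
  then obtain B where B: "{h} \<subseteq> B" "B \<subseteq> V" "independent B" "V \<subseteq> span B"
    using maximal_independent_subset_extend[of "{h}" V] h(1) by auto
  have finB: "finite B" using B(3) by (rule independent_imp_finite)
  have cardB: "card B = dim V" using basis_card_eq_dim[OF B(2,4,3)] .
  define R where "R = B - {h}"
  define a where "a = h - \<Sum>R"
  have finR: "finite R" using finB by (simp add: R_def)
  have "h \<notin> span R" using B(1,3) by (auto simp: R_def dependent_def)
  moreover have "\<Sum>R \<in> span R" by (auto intro: span_sum span_base)
  ultimately have a0: "a \<noteq> 0" by (auto simp: a_def)
  have sumV: "\<Sum>R \<in> V" using B(2) by (intro subspace_sum[OF V]) (auto simp: R_def)
  have "card (insert a R) \<le> Suc (card R)" by (simp add: card_insert_if finR)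
  also have "Suc (card R) = dim V" using card_Suc_Diff1[OF finB, of h] B(1) cardB by (simp add: R_def)
  finally have "card (insert a R) \<le> dim V" .
  moreover have "insert a R \<subseteq> V" using B(2) subspace_diff[OF V h(1) sumV] by (auto simp: R_def a_def)
  moreover have "0 \<notin> insert a R" using a0 dependent_zero[of B] B(3) by (auto simp: R_def)
  moreover have "(\<exists>w\<in>insert a R. n \<bullet> w < 0) \<or> (\<forall>y\<in>V. n \<bullet> y = 0)" if n: "n \<bullet> h \<le> 0" for n
  proof (rule disjCI)
    assume "\<not> (\<forall>y\<in>V. n \<bullet> y = 0)"
    show "\<exists>w\<in>insert a R. n \<bullet> w < 0"
    proof (rule ccontr)
      assume "\<not> ?thesis"
      then have nonneg: "n \<bullet> a \<ge> 0" "\<And>b. b \<in> R \<Longrightarrow> n \<bullet> b \<ge> 0"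
        by (simp_all add: not_less)
      \<comment> \<open>Nonnegative numbers with sum at most 0 all vanish, so \<open>n\<close> is
        zero on the whole basis \<open>B\<close> and hence on \<open>V\<close>.\<close>
      have sum_eq: "n \<bullet> a + (\<Sum>b\<in>R. n \<bullet> b) = n \<bullet> h" by (simp add: a_def inner_diff_right inner_sum_right)
      have "(\<Sum>b\<in>R. n \<bullet> b) \<ge> 0" using nonneg(2) by (rule sum_nonneg)
      then have "(\<Sum>b\<in>R. n \<bullet> b) = 0" "n \<bullet> h = 0" using sum_eq nonneg(1) n by linarith+
      moreover have "\<forall>b\<in>R. n \<bullet> b = 0"
        using sum_nonneg_eq_0_iff[OF finR, of "\<lambda>b. n \<bullet> b"] nonneg(2) calculation(1) by simp
      ultimately have "n \<bullet> b = 0" if "b \<in> B" for b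
        using that by (cases "b = h") (auto simp: R_def)
      then have "n \<bullet> y = 0" if "y \<in> span B" for y
        using orthogonal_to_span[OF that, of n] by (simp add: orthogonal_def)
      then show False using \<open>\<not> (\<forall>y\<in>V. n \<bullet> y = 0)\<close> B(4) by blast
    qed
  qed
  ultimately show ?thesis using that[of "insert a R"] finR by simp
qed

text \<open>
  The point \<open>h = p - k c\<close> lies just outside the cap at \<open>p\<close>. As \<open>p\<close> is interior to \<open>K\<close> and the cap
  is strictly convex, the source \<open>-h\<close> illuminates every boundary point of the truncated body that
  comes from the boundary of \<open>K\<close>. The other boundary points are smooth.
\<close>
lemma exists_illuminating_set_Int_cap:
  fixes K :: "'a::euclidean_space set"
  assumes dim: "DIM('a) \<ge> 2" and K: "sph_convex_body K" and \<rho>: "\<rho> > 0"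
    and z: "z \<in> interior (punctured_cone K)" "c \<bullet> z > \<rho> * norm z"
    and p: "p \<in> interior (punctured_cone K)" "norm p = 1" "c \<bullet> p = \<rho>"
  obtains S G where "finite S" "card S \<le> DIM('a)" "illuminates S {y \<in> K. c \<bullet> y \<ge> \<rho>}"
    "greatsphere (DIM('a) - 2) G" "G \<inter> {y \<in> K. c \<bullet> y \<ge> \<rho>} = {}" "S \<subseteq> G"
proof -
  define L where "L = {y \<in> K. c \<bullet> y \<ge> \<rho>}"
  have L: "sph_convex_body L" unfolding L_def by (rule sph_convex_body_Int_cap[OF K \<rho> z])
  have cL: "compact L" and sL: "sph_convex L" using L by (auto simp: sph_convex_body_def)
  have sK: "sph_convex K" using K by (simp add: sph_convex_body_def)
  note interiorL = interior_punctured_cone_Int_cap[of _ K \<rho> c, folded L_def]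
  have unit: "norm y = 1" if "y \<in> L" for y using that subset_unit_sphere[OF sL] by auto
  have capL: "c \<bullet> y \<ge> \<rho>" "y \<in> K" if "y \<in> L" for y using that by (auto simp: L_def)

  have z0: "z \<noteq> 0" using subsetD[OF interior_subset z(1)] by (simp add: punctured_cone_def)
  \<comment> \<open>A point strictly inside the cap forces \<rho> below \<open>norm c\<close> by
    Cauchy-Schwarz; this gap later makes \<open>v\<close> positive on \<open>L\<close>.\<close>
  have "\<rho> * norm z < norm c * norm z" using z(2) norm_cauchy_schwarz[of c z] by linarith
  then have "\<rho> < norm c" using z0 by simp
  then have "\<rho> * \<rho> < norm c * norm c" using \<rho> by (intro mult_strict_mono) auto
  then have N: "\<rho> * \<rho> < c \<bullet> c" by (simp add: dot_square_norm power2_eq_square)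

  \<comment> \<open>\<open>D\<close> is the part of \<open>L\<close> on the boundary of
    \<open>K\<close>. It is compact and omits \<open>p\<close>, so \<open>q + p\<close> is interior
    to the cone over \<open>L\<close> for \<open>q\<close> in \<open>D\<close>, with a uniform
    margin \<open>e\<close> that allows \<open>p\<close> to be moved slightly.\<close>
  define D where "D = L - interior (punctured_cone K)"
  have "compact ((\<lambda>q. q + p) ` D)"
    unfolding D_def by (intro compact_continuous_image compact_diff cL continuous_intros) auto
  moreover have "(\<lambda>q. q + p) ` D \<subseteq> interior (punctured_cone L)"
  proof (rule image_subsetI)
    fix q assume q: "q \<in> D"
    then have qL: "q \<in> L" "norm q = 1" "q \<noteq> p" using unit p(1) by (auto simp: D_def)
    have "q \<in> punctured_cone K" using qL(2) capL(2)[OF qL(1)] by (simp add: mem_punctured_cone_unit)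
    then have "q + p \<in> interior (punctured_cone K)"
      using interior_punctured_cone_add[OF sK p(1)] by (simp add: add.commute[of q])
    moreover have "\<rho> * norm (q + p) < \<rho> * (norm q + norm p)"
      using norm_add_less_add_norm[OF p(2) qL(2)] qL(3) \<rho> by auto
    then have "\<rho> * norm (q + p) < c \<bullet> (q + p)"
      using capL(1)[OF qL(1)] by (simp add: qL(2) p(2,3) inner_add_right)
    ultimately show "q + p \<in> interior (punctured_cone L)" by (rule interiorL)
  qed
  ultimately obtain e where e: "e > 0"
    "(\<Union>x\<in>(\<lambda>q. q + p) ` D. ball x e) \<subseteq> interior (punctured_cone L)"
    using compact_subset_open_imp_ball_epsilon_subset open_interior by blast

  \<comment> \<open>The first bound, with its factor 2, keeps \<open>k * norm c\<close> strictly
    below the margin \<open>e\<close>; the second keeps \<open>\<rho> - k * (c \<bullet> c)\<close>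
    nonnegative, as the estimate for \<open>v\<close> requires.\<close>
  define k where "k = min (e / (2 * norm c)) (\<rho> / (c \<bullet> c))"
  have cc: "c \<bullet> c > 0" using N \<rho> by (meson less_trans mult_pos_pos)
  have nc: "norm c > 0" using \<open>\<rho> < norm c\<close> \<rho> by linarith
  have k0: "k > 0" using e(1) nc cc \<rho> by (simp add: k_def)
  have "k * norm c \<le> e / (2 * norm c) * norm c" by (intro mult_right_mono) (auto simp: k_def)
  then have ke: "k * norm c < e" using e(1) nc by simp
  have "k * (c \<bullet> c) \<le> \<rho> / (c \<bullet> c) * (c \<bullet> c)" using cc by (intro mult_right_mono) (auto simp: k_def)
  then have kN: "k * (c \<bullet> c) \<le> \<rho>" using cc by simp
  have "k * (\<rho> * \<rho>) < k * (c \<bullet> c)" using k0 N by simp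
  then have "(k * \<rho>) * \<rho> < 1 * \<rho>" using kN by (simp add: mult.assoc)
  then have k\<rho>: "k * \<rho> < 1" using \<rho> by (simp only: mult_less_cancel_right_pos)

  define h where "h = p - k *\<^sub>R c"
  have pp: "p \<bullet> p = 1" using p(2) by (simp add: dot_square_norm)
  have "p \<bullet> h > 0" using k\<rho> p(3) by (simp add: h_def inner_diff_right pp inner_commute)
  then have h0: "h \<noteq> 0" by auto
  have far: "q + h \<in> interior (punctured_cone L)" if "q \<in> D" for q
  proof -
    have "q + h \<in> ball (q + p) e" using ke k0 by (simp add: h_def dist_norm)
    then show ?thesis using e(2) that by blast
  qed

  \<comment> \<open>This is \<open>(p \<bullet> h) c - (c \<bullet> h) p\<close>, a combination of
    \<open>c\<close> and \<open>p\<close> orthogonal to \<open>h\<close>. On \<open>L\<close>, where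
    \<open>c \<bullet> y \<ge> \<rho>\<close> and \<open>p \<bullet> y \<le> 1\<close>, it is at
    least \<open>k (c \<bullet> c - \<rho> \<rho>)\<close>.\<close>
  define v where "v = (1 - k * \<rho>) *\<^sub>R c - (\<rho> - k * (c \<bullet> c)) *\<^sub>R p"
  have vh: "v \<bullet> h = 0"
    by (simp add: v_def h_def inner_diff_left inner_diff_right pp p(3) inner_commute[of p c] algebra_simps)
  have v_pos: "v \<bullet> y > 0" if "y \<in> L" for y
  proof -
    have "p \<bullet> y \<le> 1" using norm_cauchy_schwarz[of p y] p(2) unit[OF that] by simp
    then have "(\<rho> - k * (c \<bullet> c)) * (p \<bullet> y) \<le> (\<rho> - k * (c \<bullet> c)) * 1"
      using kN by (intro mult_left_mono) auto
    moreover have "(1 - k * \<rho>) * (c \<bullet> y) \<ge> (1 - k * \<rho>) * \<rho>"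
      using k\<rho> capL(1)[OF that] by (intro mult_left_mono) auto
    moreover have "(1 - k * \<rho>) * \<rho> - (\<rho> - k * (c \<bullet> c)) * 1 > 0"
      using \<open>k * (\<rho> * \<rho>) < k * (c \<bullet> c)\<close> by (simp add: algebra_simps)
    ultimately show ?thesis by (simp add: v_def inner_diff_left)
  qed
  have Lne: "L \<noteq> {}" using L by (auto simp: sph_convex_body_def)
  then have v0: "v \<noteq> 0" using v_pos by force
  define V where "V = {y. v \<bullet> y = 0}"
  have V: "subspace V" "dim V = DIM('a) - 1"
    using v0 by (simp_all add: V_def subspace_hyperplane dim_hyperplane)
  have hV: "h \<in> V" by (simp add: V_def vh)
  obtain T where T: "finite T" "card T \<le> dim V" "T \<subseteq> V" "0 \<notin> T"
    "\<And>n. n \<bullet> h \<le> 0 \<Longrightarrow> (\<exists>w\<in>T. n \<bullet> w < 0) \<or> (\<forall>y\<in>V. n \<bullet> y = 0)"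
    using exists_subset_detecting_nonpos[OF V(1) hV h0] by blast
  define W where "W = insert (- h) T"
  have W: "w \<noteq> 0" "v \<bullet> w = 0" if "w \<in> W" for w
    using that h0 vh T(3,4) by (auto simp: W_def V_def)
  have step: "\<exists>w\<in>W. \<exists>s>0. q - s *\<^sub>R w \<in> interior (punctured_cone L)"
    if q: "q \<in> L" "q \<notin> interior (punctured_cone L)" for q
  proof (cases "q \<in> D")
    case True
    then have "q - 1 *\<^sub>R (- h) \<in> interior (punctured_cone L)" using far by simp
    moreover have "- h \<in> W" by (simp add: W_def)
    ultimately show ?thesis using zero_less_one by blast
  next
    case False
    then have qK: "q \<in> interior (punctured_cone K)" using q(1) by (simp add: D_def)
    have "\<not> c \<bullet> q > \<rho> * norm q" using interiorL[OF qK] q(2) by blast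
    then have cq: "c \<bullet> q = \<rho>" using unit[OF q(1)] capL(1)[OF q(1)] by simp
    \<comment> \<open>At such a point \<open>q\<close> of the rim, \<open>n\<close> is the inner
      normal of the cap, and every direction positive on \<open>n\<close> leads into the
      interior.\<close>
    define n where "n = c - \<rho> *\<^sub>R q"
    have qq: "q \<bullet> q = 1" using unit[OF q(1)] by (simp add: dot_square_norm)
    have towards: "\<exists>s>0. q + s *\<^sub>R w \<in> interior (punctured_cone L)" if "n \<bullet> w > 0" for w
      using exists_step_into_open_cap[OF open_interior qK unit[OF q(1)] cq \<rho>, of w] that interiorL
      unfolding n_def by blast
    show ?thesis
    proof (cases "n \<bullet> h > 0")
      case True
      then obtain s where "s > 0" "q + s *\<^sub>R h \<in> interior (punctured_cone L)" using towards by blast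
      then have "q - s *\<^sub>R (- h) \<in> interior (punctured_cone L)" by simp
      moreover have "- h \<in> W" by (simp add: W_def)
      ultimately show ?thesis using \<open>s > 0\<close> by blast
    next
      case False
      \<comment> \<open>As \<open>n \<bullet> q = 0\<close> and \<open>q\<close> is not in
        \<open>V\<close>, a normal vanishing on \<open>V\<close> would vanish everywhere, in
        particular at \<open>z\<close>; but \<open>z\<close> lies strictly inside the cap.\<close>
      have "\<not> (\<forall>y\<in>V. n \<bullet> y = 0)"
      proof
        assume perp: "\<forall>y\<in>V. n \<bullet> y = 0"
        have vq: "v \<bullet> q > 0" by (rule v_pos[OF q(1)])
        have nq: "n \<bullet> q = 0" by (simp add: n_def inner_diff_left cq qq)
        have "z - ((v \<bullet> z) / (v \<bullet> q)) *\<^sub>R q \<in> V" using vq by (simp add: V_def inner_diff_right)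
        then have "n \<bullet> z = 0" using perp nq by (force simp: inner_diff_right)
        then have "c \<bullet> z = \<rho> * (q \<bullet> z)" by (simp add: n_def inner_diff_left)
        also have "\<dots> \<le> \<rho> * (norm q * norm z)"
          using \<rho> norm_cauchy_schwarz[of q z] by (intro mult_left_mono) auto
        finally show False using z(2) unit[OF q(1)] by simp
      qed
      then obtain w where w: "w \<in> T" "n \<bullet> w < 0" using T(5)[of n] False by auto
      then obtain s where "s > 0" "q + s *\<^sub>R (- w) \<in> interior (punctured_cone L)"
        using towards[of "- w"] by auto
      then have "q - s *\<^sub>R w \<in> interior (punctured_cone L)" by simp
      then show ?thesis using \<open>s > 0\<close> w(1) unfolding W_def by blast
    qed
  qed

  define S where "S = sgn ` W"
  define G where "G = V \<inter> unit_sphere"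
  have finW: "finite W" using T(1) by (simp add: W_def)
  \<comment> \<open>\<open>T\<close> contributes at most \<open>DIM('a) - 1\<close> sources and
    \<open>- h\<close> one more; normalizing can only merge them.\<close>
  have "card S \<le> card W" unfolding S_def using finW by (rule card_image_le)
  also have "card W \<le> Suc (card T)" by (simp add: W_def card_insert_if T(1))
  also have "\<dots> \<le> DIM('a)" using T(2) V(2) dim by simp
  finally have cardS: "card S \<le> DIM('a)" .
  have GL: "G \<inter> L = {}" using v_pos by (force simp: G_def V_def)
  have SG: "S \<subseteq> G"
    using W by (auto simp: S_def G_def V_def norm_sgn) (simp add: sgn_div_norm)
  have "DIM('a) - 1 = DIM('a) - 2 + 1" using dim by linarith
  then have G: "greatsphere (DIM('a) - 2) G" using V unfolding greatsphere_def G_def by auto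
  have "illuminates S L"
  proof -
    have "S \<subseteq> unit_sphere - L" using SG GL by (auto simp: G_def)
    moreover have "\<exists>s\<in>S. illuminated_from L s q" if "q \<in> sph_boundary L" for q
    proof -
      have q: "q \<in> L - sph_interior L"
        using that sph_boundary_eq[OF cL subset_unit_sphere[OF sL]] by simp
      then have "q \<notin> interior (punctured_cone L)" using unit by (auto simp: sph_interior_iff)
      then obtain w s where w: "w \<in> W" "s > 0" "q - s *\<^sub>R w \<in> interior (punctured_cone L)"
        using step q by blast
      have "illuminated_from L (sgn w) q"
        by (rule illuminated_from_sgnI[OF sL W(2)[OF w(1)] v_pos W(1)[OF w(1)] q w(2,3)])
      then show ?thesis using w(1) by (auto simp: S_def)
    qed
    ultimately show ?thesis by (simp add: illuminates_def)
  qed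
  then show ?thesis
    using that[of S G] finW cardS G GL SG by (simp add: S_def L_def)
qed

section \<open>Choice of the cap and value of the illumination number\<close>

theorem corollary1:
  fixes K :: "'a::euclidean_space set" and d :: nat and \<epsilon> :: real
  assumes "DIM('a) = d + 1" and "d > 2"
    and "sph_convex_body K" and "\<epsilon> > 0"
  shows "\<exists>K'. sph_convex_body K' \<and> K' \<subseteq> K \<and>
           (\<exists>c\<in>unit_sphere. K - K' \<subseteq> sph_cap c \<epsilon>) \<and>
           illumination_number K' = enat (d + 1)"
proof -
  have dim: "DIM('a) \<ge> 2" using assms(1,2) by simp
  have sK: "sph_convex K" using assms(3) by (simp add: sph_convex_body_def)
  obtain c x \<mu> t where x: "x \<in> K" and t: "t > 0" and \<mu>: "\<mu> > 0" and cx: "c \<bullet> x = \<mu>"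
    and min: "\<And>y. y \<in> K \<Longrightarrow> c \<bullet> y \<ge> \<mu> + t * (1 - x \<bullet> y)"
    by (rule exists_strict_inner_minimizer[OF assms(3)]) (rule that)
  have nx: "norm x = 1" using x subset_unit_sphere[OF sK] by auto
  let ?J = "interior (punctured_cone K)"
  \<comment> \<open>A nonempty open set does not fit into a line, so some interior \<open>z\<close>
    is not a multiple of \<open>x\<close>. Cauchy-Schwarz is then strict and \<open>c\<close>
    exceeds its minimum at \<open>sgn z\<close>.\<close>
  have "dim (span {x}) < DIM('a)"
    using dim dim_le_card'[of "{x}"] by (simp add: dim_span)
  then have "interior (span {x}) = {}" by (rule empty_interior_lowdim)
  moreover have "?J \<noteq> {}" using assms(3) by (auto simp: sph_convex_body_def sph_interior_iff)
  ultimately have "\<not> ?J \<subseteq> span {x}" using interior_maximal[OF _ open_interior] by blast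
  then obtain z where z: "z \<in> ?J" "z \<notin> span {x}" by blast
  have zP: "z \<noteq> 0" "sgn z \<in> K" using subsetD[OF interior_subset z(1)] by (auto simp: punctured_cone_def)
  have "x \<bullet> z < norm z"
  proof -
    have "x \<bullet> z \<noteq> norm x * norm z"
    proof
      assume "x \<bullet> z = norm x * norm z"
      then have "z = norm z *\<^sub>R x" using norm_cauchy_schwarz_eq[of x z] by (simp add: nx)
      moreover have "norm z *\<^sub>R x \<in> span {x}" by (intro span_scale span_base) simp
      ultimately show False using z(2) by simp
    qed
    then show ?thesis using norm_cauchy_schwarz[of x z] nx by simp
  qed
  then have "1 - x \<bullet> sgn z > 0" using zP(1) by (simp add: sgn_div_norm field_simps)
  then have "t * (1 - x \<bullet> sgn z) > 0" using t by simp
  then have gap: "\<mu> < c \<bullet> sgn z" using min[OF zP(2)] by linarith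

  \<comment> \<open>Capping at \<open>pi\<close> keeps the angle in the range where
    \<open>cos\<close> decreases and \<open>arccos\<close> inverts it.\<close>
  define \<epsilon>' where "\<epsilon>' = min \<epsilon> pi"
  have \<epsilon>': "0 < \<epsilon>'" "\<epsilon>' \<le> pi" "\<epsilon>' \<le> \<epsilon>" using assms(4) by (auto simp: \<epsilon>'_def)
  have "cos \<epsilon>' < cos 0" using \<epsilon>' by (intro cos_monotone_0_pi) auto
  \<comment> \<open>The first bound on \<rho> keeps \<open>z\<close> strictly inside the cap; the
    second forces every removed point to within angle \<open>\<epsilon>'\<close> of
    \<open>x\<close>.\<close>
  then have "\<mu> < min (c \<bullet> sgn z) (\<mu> + t * (1 - cos \<epsilon>'))" using gap t by simp
  from dense[OF this]
  obtain \<rho> where \<rho>: "\<mu> < \<rho>" "\<rho> < c \<bullet> sgn z" "\<rho> < \<mu> + t * (1 - cos \<epsilon>')" by auto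
  have \<rho>0: "\<rho> > 0" using \<rho>(1) \<mu> by simp
  have cz: "c \<bullet> z > \<rho> * norm z" using \<rho>(2) zP(1) by (simp add: sgn_div_norm field_simps)

  \<comment> \<open>On the line segment from \<open>x\<close>, outside the cap, to \<open>z\<close>,
    inside it, the intermediate value theorem finds a crossing of the rim. As \<open>s > 0\<close>
    and \<open>z\<close> is interior, so is the crossing; its direction serves as the rim point
    \<open>p\<close>.\<close>
  define Y where "Y s = (1 - s) *\<^sub>R x + s *\<^sub>R z" for s :: real
  have "\<exists>s\<ge>0. s \<le> 1 \<and> c \<bullet> Y s - \<rho> * norm (Y s) = 0"
    using \<rho>(1) cz cx nx unfolding Y_def by (intro IVT') (auto intro!: continuous_intros)
  then obtain s where s: "0 \<le> s" "s \<le> 1" "c \<bullet> Y s = \<rho> * norm (Y s)" by auto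
  have "s \<noteq> 0" using s(3) \<rho>(1) cx nx by (auto simp: Y_def)
  moreover have "s \<noteq> 1" using s(3) cz by (auto simp: Y_def)
  ultimately have s01: "0 < s" "s < 1" using s by auto
  have "(1 - s) *\<^sub>R x \<in> punctured_cone K"
    using x nx s01 by (simp add: punctured_cone_scale_iff mem_punctured_cone_unit)
  from interior_punctured_cone_add[OF sK interior_punctured_cone_scale[OF z(1) s01(1)] this]
  have YJ: "Y s \<in> ?J" by (simp add: Y_def add.commute)
  have Y0: "Y s \<noteq> 0" using subsetD[OF interior_subset YJ] by (simp add: punctured_cone_def)
  have p: "sgn (Y s) \<in> ?J" "norm (sgn (Y s)) = 1"
    using sgn_in_sph_interior[OF YJ] by (auto simp: sph_interior_iff)
  have cp: "c \<bullet> sgn (Y s) = \<rho>" using s(3) Y0 by (simp add: sgn_div_norm field_simps)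

  define K' where "K' = {y \<in> K. c \<bullet> y \<ge> \<rho>}"
  have K': "sph_convex_body K'" unfolding K'_def by (rule sph_convex_body_Int_cap[OF assms(3) \<rho>0 z(1) cz])
  have "K - K' \<subseteq> sph_cap x \<epsilon>"
  proof
    fix y assume y: "y \<in> K - K'"
    then have yK: "y \<in> K" "c \<bullet> y < \<rho>" by (auto simp: K'_def)
    have ny: "norm y = 1" using yK(1) subset_unit_sphere[OF sK] by auto
    have "t * (1 - x \<bullet> y) < t * (1 - cos \<epsilon>')" using min[OF yK(1)] yK(2) \<rho>(3) by linarith
    then have "cos \<epsilon>' \<le> x \<bullet> y" using t by simp
    moreover have "\<bar>x \<bullet> y\<bar> \<le> 1" using Cauchy_Schwarz_ineq2[of x y] nx ny by simp
    ultimately have "arccos (x \<bullet> y) \<le> arccos (cos \<epsilon>')" by (intro arccos_le_arccos) auto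
    then show "y \<in> sph_cap x \<epsilon>" using \<epsilon>' ny by (simp add: sph_cap_def arccos_cos)
  qed
  moreover have "illumination_number K' = enat (d + 1)"
  proof -
    obtain S G where S: "finite S" "card S \<le> DIM('a)" "illuminates S K'"
      "greatsphere (DIM('a) - 2) G" "G \<inter> K' = {}" "S \<subseteq> G"
      using exists_illuminating_set_Int_cap[OF dim assms(3) \<rho>0 z(1) cz p cp] unfolding K'_def by blast
    \<comment> \<open>The lower bound turns the upper bound on \<open>card S\<close> into an
      equality, so the infimum is attained by \<open>S\<close>.\<close>
    have "card S = DIM('a)"
      using card_illuminating_ge[OF dim K' S(1,3,6,4,5)] S(2) by simp
    then have card: "enat (d + 1) = enat (card S)" using assms(1) by simp
    let ?A = "{enat (card S) |S. finite S \<and> illuminates S K' \<and>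
        (\<exists>G. greatsphere (DIM('a) - 2) G \<and> G \<inter> K' = {} \<and> S \<subseteq> G)}"
    have "enat (d + 1) \<in> ?A" unfolding card using S by blast
    then have "Inf ?A \<le> enat (d + 1)" by (rule Inf_lower)
    moreover have "enat (d + 1) \<le> Inf ?A"
    proof (rule Inf_greatest)
      fix n assume "n \<in> ?A"
      then obtain S' G' where "n = enat (card S')" "finite S'" "illuminates S' K'"
        "greatsphere (DIM('a) - 2) G'" "G' \<inter> K' = {}" "S' \<subseteq> G'" by blast
      then show "enat (d + 1) \<le> n" using card_illuminating_ge[OF dim K', of S' G'] assms(1) by simp
    qed
    ultimately show ?thesis unfolding illumination_number_def by (rule antisym)
  qed
  ultimately show ?thesis using K' nx by (intro exI[of _ K']) (auto simp: K'_def)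
qed

end
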